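(* There is an absolute constant $C$ such that for all $n\ge2$ and $W$, $$\mathrm{efg}(n,W)\le C\cdot\max\{\mathrm{vfg}(n',W') : n'\le Cn\log n,\ W'\le CW\}.$$
   Context: For a directed graph $G=(V,E)$ with nonnegative edge weights $w$, $\mathrm{dist}_w(s,t)$ is the minimum total edge weight of an $s\leadsto t$ path. $\mathrm{efg}(n,W)$ is the least integer such that for every $n$-node directed graph with nonnegative edge costs $\mathrm{cost}$ and nonnegative edge weights $w$ with $w(E)=W$, there is $X\subseteq E$ such that every $s\leadsto t$ path contains an edge of $X$ whenever $\mathrm{dist}_w(s,t)\ge1$, and $\mathrm{cost}(X)\le\langle\mathrm{cost},w\rangle\cdot\mathrm{efg}(n,W)$, where $\mathrm{cost}(X)=\sum_{e\in X}\mathrm{cost}(e)$ and $\langle\mathrm{cost},w\rangle=\sum_e\mathrm{cost}(e)w(e)$. For vertex weights $w$, $\mathrm{vdist}_w(s,t)$ is the minimum over $s\leadsto t$ paths of the total weight of interior vertices (excluding $s,t$). $\mathrm{vfg}(n,W)$ is the least integer such that for every $n$-node directed graph with nonnegative vertex costs and nonnegative vertex weights $w$ with $w(V)=W$, there is $X\subseteq V$ such that every $s\leadsto t$ path contains an internal node in $X$ whenever $\mathrm{vdist}_w(s,t)\ge1$, and $\mathrm{cost}(X)\le\langle\mathrm{cost},w\rangle\cdot\mathrm{vfg}(n,W)$. *)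

theory Defs
  imports Complex_Main "Graph_Theory.Graph_Theory"
begin

text \<open>
  A directed graph is a finite vertex set together with a set of ordered pairs of vertices
  (\<^locale>\<open>pair_fin_digraph\<close>): no parallel edges, loops allowed. Loops never lie on a simple path, so
  they only make \<open>efg\<close> possibly larger (a loop can carry part of the total weight) and leave
  \<open>vfg\<close> unchanged. Paths are simple directed paths (\<^const>\<open>pre_digraph.apath\<close>); since weights are
  nonnegative, replacing them by walks would change neither the distances nor the cuts.
  Distances are extended reals: \<open>\<infinity>\<close> if there is no path from \<open>s\<close> to \<open>t\<close>, and \<open>0\<close> if \<open>s = t\<close>.
\<close>

abbreviation edge_dist :: "'a pair_pre_digraph \<Rightarrow> ('a \<times> 'a \<Rightarrow> real) \<Rightarrow> 'a \<Rightarrow> 'a \<Rightarrow> ereal" where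
  "edge_dist G w s t \<equiv> wf_digraph.\<mu> (with_proj G) w s t"

definition vertex_dist :: "'a pair_pre_digraph \<Rightarrow> ('a \<Rightarrow> real) \<Rightarrow> 'a \<Rightarrow> 'a \<Rightarrow> ereal" where
  "vertex_dist G w s t =
     (INF p\<in>{p. pre_digraph.apath (with_proj G) s p t}.
        ereal (sum_list (map w (pre_digraph.inner_verts (with_proj G) p))))"

definition edge_cut :: "'a pair_pre_digraph \<Rightarrow> ('a \<times> 'a \<Rightarrow> real) \<Rightarrow> ('a \<times> 'a) set \<Rightarrow> bool" where
  "edge_cut G w X \<longleftrightarrow> X \<subseteq> parcs G \<and>
     (\<forall>s\<in>pverts G. \<forall>t\<in>pverts G. edge_dist G w s t \<ge> 1 \<longrightarrow>
        (\<forall>p. pre_digraph.apath (with_proj G) s p t \<longrightarrow> set p \<inter> X \<noteq> {}))"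

definition vertex_cut :: "'a pair_pre_digraph \<Rightarrow> ('a \<Rightarrow> real) \<Rightarrow> 'a set \<Rightarrow> bool" where
  "vertex_cut G w X \<longleftrightarrow> X \<subseteq> pverts G \<and>
     (\<forall>s\<in>pverts G. \<forall>t\<in>pverts G. vertex_dist G w s t \<ge> 1 \<longrightarrow>
        (\<forall>p. pre_digraph.apath (with_proj G) s p t \<longrightarrow>
           set (pre_digraph.inner_verts (with_proj G) p) \<inter> X \<noteq> {}))"

text \<open>
  Both notions are invariant under graph isomorphism, so it suffices to let the \<open>n\<close> vertices be
  natural numbers. The least integer is taken among the nonnegative ones; this only matters when
  \<open>\<langle>cost, w\<rangle> = 0\<close> for all admissible instances (e.g. \<open>W = 0\<close>), where every negative integer would
  qualify as well.
\<close>

definition edge_gap_bound :: "nat \<Rightarrow> real \<Rightarrow> nat \<Rightarrow> bool" where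
  "edge_gap_bound n W k \<longleftrightarrow>
     (\<forall>(G :: nat pair_pre_digraph) cost w.
        pair_fin_digraph G \<and> card (pverts G) = n \<and>
        (\<forall>e\<in>parcs G. cost e \<ge> 0) \<and> (\<forall>e\<in>parcs G. w e \<ge> 0) \<and>
        (\<Sum>e\<in>parcs G. w e) = W \<longrightarrow>
        (\<exists>X. edge_cut G w X \<and>
             (\<Sum>e\<in>X. cost e) \<le> (\<Sum>e\<in>parcs G. cost e * w e) * real k))"

definition vertex_gap_bound :: "nat \<Rightarrow> real \<Rightarrow> nat \<Rightarrow> bool" where
  "vertex_gap_bound n W k \<longleftrightarrow>
     (\<forall>(G :: nat pair_pre_digraph) cost w.
        pair_fin_digraph G \<and> card (pverts G) = n \<and>
        (\<forall>v\<in>pverts G. cost v \<ge> 0) \<and> (\<forall>v\<in>pverts G. w v \<ge> 0) \<and>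
        (\<Sum>v\<in>pverts G. w v) = W \<longrightarrow>
        (\<exists>X. vertex_cut G w X \<and>
             (\<Sum>v\<in>X. cost v) \<le> (\<Sum>v\<in>pverts G. cost v * w v) * real k))"

definition efg :: "nat \<Rightarrow> real \<Rightarrow> nat" where
  "efg n W = (LEAST k. edge_gap_bound n W k)"

definition vfg :: "nat \<Rightarrow> real \<Rightarrow> nat" where
  "vfg n W = (LEAST k. vertex_gap_bound n W k)"

text \<open>
  Both minima exist: on a simple path of length at least \<open>1\<close> some edge (interior vertex) has weight
  at least \<open>1 / n\<close>, so thresholding at \<open>1 / n\<close> shows that \<open>n\<close> is always a valid bound.
\<close>

lemma sum_list_less_one:
  fixes f :: "'b \<Rightarrow> real"
  assumes "\<And>x. x \<in> set xs \<Longrightarrow> f x * real n < 1" and "length xs < n"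
  shows "sum_list (map f xs) < 1"
proof -
  have n: "real n > 0" using assms(2) by simp
  have "sum_list (map f xs) \<le> sum_list (map (\<lambda>_. 1 / real n) xs)"
    using assms(1) n by (intro sum_list_mono) (force simp: field_simps)
  also have "\<dots> = real (length xs) / real n"
    by (simp add: sum_list_triv)
  also have "\<dots> < 1" using assms(2) n by simp
  finally show ?thesis .
qed

lemma threshold_cost:
  fixes c w :: "'b \<Rightarrow> real"
  assumes "finite A" "\<forall>x\<in>A. c x \<ge> 0" "\<forall>x\<in>A. w x \<ge> 0"
  shows "(\<Sum>x\<in>{x\<in>A. w x * real n \<ge> 1}. c x) \<le> (\<Sum>x\<in>A. c x * w x) * real n"
proof -
  have "(\<Sum>x\<in>{x\<in>A. w x * real n \<ge> 1}. c x) \<le> (\<Sum>x\<in>{x\<in>A. w x * real n \<ge> 1}. c x * (w x * real n))"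
    using assms(2) by (intro sum_mono) (use mult_left_mono[of 1] in fastforce)
  also have "\<dots> \<le> (\<Sum>x\<in>A. c x * (w x * real n))"
    using assms by (intro sum_mono2) auto
  also have "\<dots> = (\<Sum>x\<in>A. c x * w x) * real n"
    by (simp add: sum_distrib_right mult.assoc)
  finally show ?thesis .
qed

lemma apath_length_less:
  assumes "pair_fin_digraph G" and "pre_digraph.apath (with_proj G) s p t"
  shows "length p < card (pverts G)"
proof -
  interpret pair_fin_digraph G by fact
  have p: "awalk s p t" "distinct (pawalk_verts s p)"
    using assms(2) by (auto simp: apath_def)
  have "set (pawalk_verts s p) \<subseteq> pverts G"
    using p(1) by (auto dest: awalk_verts_in_verts)
  then have "length (pawalk_verts s p) \<le> card (pverts G)"
    using p(2) by (metis card_mono distinct_card pair_finite_verts)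
  moreover have "length (pawalk_verts u q) = Suc (length q)" for u :: 'a and q
    by (induction q arbitrary: u) auto
  ultimately show ?thesis by simp
qed

lemma edge_gap_bound_card: "edge_gap_bound n W n"
  unfolding edge_gap_bound_def
proof (intro allI impI)
  fix G :: "nat pair_pre_digraph" and cost w :: "nat \<times> nat \<Rightarrow> real"
  assume *: "pair_fin_digraph G \<and> card (pverts G) = n \<and>
    (\<forall>e\<in>parcs G. cost e \<ge> 0) \<and> (\<forall>e\<in>parcs G. w e \<ge> 0) \<and> (\<Sum>e\<in>parcs G. w e) = W"
  interpret pair_fin_digraph G using * by blast
  let ?X = "{e\<in>parcs G. w e * real n \<ge> 1}"
  have "edge_cut G w ?X"
    unfolding edge_cut_def
  proof (intro conjI ballI allI impI)
    fix s t p assume d: "edge_dist G w s t \<ge> 1" and p: "apath s p t"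
    have aw: "awalk s p t" using p by (auto simp: apath_def)
    have "1 \<le> ereal (awalk_cost w p)"
      using d min_cost_le_walk_cost[OF aw, of w] by (rule order_trans)
    then have "sum_list (map w p) \<ge> 1" by (simp add: awalk_cost_def)
    moreover have "length p < n" using apath_length_less[OF _ p] * by blast
    ultimately obtain e where "e \<in> set p" "w e * real n \<ge> 1"
      using sum_list_less_one[of p w n] by force
    then show "set p \<inter> ?X \<noteq> {}" using aw by (auto simp: awalk_def)
  qed auto
  then show "\<exists>X. edge_cut G w X \<and> sum cost X \<le> (\<Sum>e\<in>parcs G. cost e * w e) * real n"
    using threshold_cost[of "parcs G" cost w n] * pair_finite_arcs by blast
qed

lemma vertex_gap_bound_card: "vertex_gap_bound n W n"
  unfolding vertex_gap_bound_def
proof (intro allI impI)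
  fix G :: "nat pair_pre_digraph" and cost w :: "nat \<Rightarrow> real"
  assume *: "pair_fin_digraph G \<and> card (pverts G) = n \<and>
    (\<forall>v\<in>pverts G. cost v \<ge> 0) \<and> (\<forall>v\<in>pverts G. w v \<ge> 0) \<and> (\<Sum>v\<in>pverts G. w v) = W"
  interpret pair_fin_digraph G using * by blast
  let ?X = "{v\<in>pverts G. w v * real n \<ge> 1}"
  have "vertex_cut G w ?X"
    unfolding vertex_cut_def
  proof (intro conjI ballI allI impI)
    fix s t p assume d: "vertex_dist G w s t \<ge> 1" and p: "apath s p t"
    have aw: "awalk s p t" using p by (auto simp: apath_def)
    have "vertex_dist G w s t \<le> ereal (sum_list (map w (inner_verts p)))"
      unfolding vertex_dist_def using p by (intro INF_lower) auto
    then have "1 \<le> ereal (sum_list (map w (inner_verts p)))"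
      using d by (rule order_trans[rotated])
    then have "sum_list (map w (inner_verts p)) \<ge> 1" by simp
    moreover have "length (inner_verts p) < n"
      using apath_length_less[OF _ p] * by (fastforce simp: inner_verts_def)
    ultimately obtain v where v: "v \<in> set (inner_verts p)" "w v * real n \<ge> 1"
      using sum_list_less_one[of "inner_verts p" w n] by force
    have "set (inner_verts p) \<subseteq> fst ` set p"
      by (cases p) (auto simp: inner_verts_def)
    also have "\<dots> \<subseteq> pverts G"
      using aw arc_fst_in_verts by (auto simp only: awalk_def)
    finally have "set (inner_verts p) \<subseteq> pverts G" .
    then show "set (inner_verts p) \<inter> ?X \<noteq> {}" using v by blast
  qed auto
  then show "\<exists>X. vertex_cut G w X \<and> sum cost X \<le> (\<Sum>v\<in>pverts G. cost v * w v) * real n"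
    using threshold_cost[of "pverts G" cost w n] * pair_finite_verts by blast
qed

lemma edge_gap_bound_efg: "edge_gap_bound n W (efg n W)"
  unfolding efg_def by (rule LeastI) (rule edge_gap_bound_card)

lemma vertex_gap_bound_vfg: "vertex_gap_bound n W (vfg n W)"
  unfolding vfg_def by (rule LeastI) (rule vertex_gap_bound_card)

lemma vfg_le: "vfg n W \<le> n"
  unfolding vfg_def by (rule Least_le) (rule vertex_gap_bound_card)

text \<open>Consequently a maximum of \<open>vfg\<close> over boundedly many vertices is a maximum of a finite set.\<close>

lemma finite_vfg_values: "finite {vfg n' W' | n' W'. real n' \<le> N \<and> P n' W'}"
proof (rule finite_subset)
  show "{vfg n' W' | n' W'. real n' \<le> N \<and> P n' W'} \<subseteq> {..nat \<lfloor>N\<rfloor>}"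
    by (auto intro!: le_nat_floor intro: order_trans[OF of_nat_mono[OF vfg_le]])
qed simp

end

theory Submission
  imports Defs "HOL-Library.Nat_Bijection"
begin

text \<open>
  Edges of weight below \<open>1 / (2n)\<close> contribute less than \<open>1/2\<close> to a simple path and may be treated as
  weightless. The other edges are rounded to \<open>O(log n)\<close> weight classes \<open>2 / 2^i\<close>, and all edges of
  class \<open>i\<close> leaving \<open>v\<close> are routed through one new vertex \<open>(v, i)\<close>, which carries the class weight
  once and the total cost of these edges. Every new vertex is charged to at least one edge, so the
  total weight grows by a constant factor only, and deleting \<open>(v, i)\<close> amounts to deleting all the
  edges routed through it. The old vertices get weight \<open>0\<close> and a prohibitive cost.
\<close>

section \<open>Rounding weights to powers of two\<close>

text \<open>For \<open>x \<ge> 1/2\<close> the class is 0; for smaller positive \<open>x\<close> it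
  is the \<open>i\<close> with \<open>2 * x < 2 / 2 ^ i \<le> 4 * x\<close>. For
  \<open>x \<le> 0\<close> the value is unspecified.\<close>

definition weight_class :: "real \<Rightarrow> nat" where
  "weight_class x = (LEAST i. 1 \<le> 2 ^ i * (2 * x))"

lemma weight_class_le: "1 \<le> 2 ^ i * (2 * x) \<Longrightarrow> weight_class x \<le> i"
  unfolding weight_class_def by (rule Least_le)

text \<open>The exponent \<open>i\<close> is a witness that the least exponent is attained.\<close>

lemma class_weight_le:
  assumes "1 \<le> 2 ^ i * (2 * x)"
  shows "2 / 2 ^ weight_class x \<le> 4 * x"
proof -
  have "1 \<le> 2 ^ weight_class x * (2 * x)"
    unfolding weight_class_def using assms by (rule LeastI)
  then show ?thesis by (simp add: field_simps)
qed

lemma class_weight_gt: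
  assumes "weight_class x \<noteq> 0"
  shows "2 * x < 2 / 2 ^ weight_class x"
proof -
  obtain j where j: "weight_class x = Suc j" using assms by (cases "weight_class x") auto
  have "\<not> 1 \<le> 2 ^ j * (2 * x)" using weight_class_le[of j x] j by auto
  then show ?thesis by (simp add: j field_simps)
qed

text \<open>An entry of class 0 that is not light rounds to 2, which suffices since all rounded
  values are nonnegative. Otherwise every entry \<open>x\<close> rounds to at least
  \<open>2 * x - 1 / n\<close>: heavy entries more than double, and light ones have
  \<open>2 * x < 1 / n\<close>. The doubled sum is at least 2, and the losses total at most
  1.\<close>

lemma rounded_sum_ge_one:
  fixes xs :: "real list"
  assumes "length xs \<le> n" "sum_list xs \<ge> 1"
  shows "(\<Sum>x\<leftarrow>xs. if 1 \<le> 2 * real n * x then 2 / 2 ^ weight_class x else (0 :: real)) \<ge> 1"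
    (is "sum_list (map ?r xs) \<ge> 1")
proof (cases "\<exists>x\<in>set xs. 1 \<le> 2 * real n * x \<and> weight_class x = 0")
  case True
  then obtain x where x: "x \<in> set xs" "?r x = 2" by fastforce
  have "?r x \<le> sum_list (map ?r xs)"
    using x(1) by (intro member_le_sum_list) auto
  then show ?thesis using x(2) by linarith
next
  case False
  have n: "n > 0" using assms by (cases n) auto
  have "real (length xs) / real n \<le> 1"
    using assms(1) n by simp
  then have "1 \<le> 2 * sum_list xs - real (length xs) / real n"
    using assms(2) by linarith
  also have "\<dots> = (\<Sum>x\<leftarrow>xs. 2 * x - 1 / real n)"
    by (simp add: sum_list_subtractf sum_list_const_mult sum_list_triv)
  also have "\<dots> \<le> sum_list (map ?r xs)"
  proof (rule sum_list_mono)
    fix x assume x: "x \<in> set xs"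
    show "2 * x - 1 / real n \<le> ?r x"
    proof (cases "1 \<le> 2 * real n * x")
      case True
      then have "weight_class x \<noteq> 0" using False x by auto
      from class_weight_gt[OF this] show ?thesis using True n
        by (smt (verit) divide_nonneg_nonneg of_nat_0_le_iff)
    next
      case F: False
      then show ?thesis using n by (simp add: field_simps)
    qed
  qed
  finally show ?thesis .
qed

section \<open>Splitting vertices by weight class\<close>

text \<open>
  The old vertex \<open>v\<close> is encoded as \<open>(v, 0)\<close>, the vertex through which the class \<open>i\<close> edges leaving
  \<open>v\<close> are routed as \<open>(v, i + 1)\<close>.
\<close>

locale class_split = pair_fin_digraph G for G :: "nat pair_pre_digraph" +
  fixes H :: "(nat \<times> nat) set" and \<kappa> :: "nat \<times> nat \<Rightarrow> nat"
  assumes H_subset: "H \<subseteq> parcs G"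
begin

definition base :: "nat \<Rightarrow> nat" where
  "base v = prod_encode (v, 0)"

definition mid :: "nat \<times> nat \<Rightarrow> nat" where
  "mid e = prod_encode (fst e, Suc (\<kappa> e))"

definition split :: "nat pair_pre_digraph" where
  "split = \<lparr>pverts = base ` pverts G \<union> mid ` H,
     parcs = (\<lambda>e. (base (fst e), base (snd e))) ` (parcs G - H) \<union>
       (\<lambda>e. (base (fst e), mid e)) ` H \<union> (\<lambda>e. (mid e, base (snd e))) ` H\<rparr>"

lemma base_eq_iff [simp]: "base u = base v \<longleftrightarrow> u = v"
  by (simp add: base_def)

lemma base_neq_mid [simp]: "base v \<noteq> mid e" "mid e \<noteq> base v"
  by (simp_all add: base_def mid_def)

lemma mid_eq_iff: "mid e = mid e' \<longleftrightarrow> fst e = fst e' \<and> \<kappa> e = \<kappa> e'"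
  by (simp add: mid_def)

lemma finite_H: "finite H"
  using H_subset pair_finite_arcs by (rule finite_subset)

lemma pverts_split: "pverts split = base ` pverts G \<union> mid ` H"
  by (simp add: split_def)

lemma parcs_splitE:
  assumes "a \<in> parcs split"
  obtains e where "e \<in> parcs G - H" "a = (base (fst e), base (snd e))"
    | e where "e \<in> H" "a = (base (fst e), mid e)"
    | e where "e \<in> H" "a = (mid e, base (snd e))"
  using assms by (auto simp: split_def)

lemma parcs_splitI:
  "e \<in> parcs G \<Longrightarrow> e \<notin> H \<Longrightarrow> (base (fst e), base (snd e)) \<in> parcs split"
  "e \<in> H \<Longrightarrow> (base (fst e), mid e) \<in> parcs split"
  "e \<in> H \<Longrightarrow> (mid e, base (snd e)) \<in> parcs split"
  by (auto simp: split_def)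

lemma pair_fin_digraph_split: "pair_fin_digraph split"
proof
  fix a assume "a \<in> parcs split"
  moreover have "fst e \<in> pverts G" "snd e \<in> pverts G" if "e \<in> H" for e
    using that H_subset arc_fst_in_verts arc_snd_in_verts by auto
  ultimately have "fst a \<in> pverts split \<and> snd a \<in> pverts split"
    by (cases rule: parcs_splitE) (auto simp: pverts_split intro: arc_fst_in_verts arc_snd_in_verts)
  then show "fst a \<in> pverts split" "snd a \<in> pverts split" by auto
next
  show "finite (pverts split)" "finite (parcs split)"
    using finite_H pair_finite_verts pair_finite_arcs by (auto simp: split_def)
qed

lemma card_pverts_split:
  assumes "\<And>e. e \<in> H \<Longrightarrow> \<kappa> e \<le> L"
  shows "card (pverts split) \<le> card (pverts G) * (L + 2)"
proof -
  \<comment> \<open>Second coordinate 0 for the old vertices and \<open>Suc (\<kappa> e)\<close>, at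
    most \<open>L + 1\<close>, for the new ones: \<open>L + 2\<close> values.\<close>
  have "pverts split \<subseteq> prod_encode ` (pverts G \<times> {..L + 1})"
    using assms H_subset by (fastforce simp: pverts_split base_def mid_def dest: wellformed')
  then have "card (pverts split) \<le> card (prod_encode ` (pverts G \<times> {..L + 1}))"
    using pair_finite_verts by (intro card_mono) auto
  also have "\<dots> \<le> card (pverts G \<times> {..L + 1})"
    using pair_finite_verts by (intro card_image_le) auto
  finally show ?thesis by (simp add: card_cartesian_product)
qed

section \<open>Walks in the graph and in its split\<close>

text \<open>Induction on the length, as crossing a new vertex consumes two arcs. The filter clause
  lets simplicity pass from \<open>q\<close> to \<open>p\<close>; since \<open>f\<close> vanishes on
  old vertices, only the new ones contribute to the sum.\<close>

lemma project_walk: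
  assumes "\<And>v. f (base v) = (0 :: real)"
    and "set q \<subseteq> parcs split" "pcas (base s) q (base t)"
  shows "\<exists>p. set p \<subseteq> parcs G \<and> pcas s p t \<and>
     filter (\<lambda>x. x \<in> range base) (pawalk_verts (base s) q) = map base (pawalk_verts s p) \<and>
     sum_list (map f (pawalk_verts (base s) q)) = (\<Sum>e\<leftarrow>p. if e \<in> H then f (mid e) else 0)"
    (is "\<exists>p. ?P s q p")
  using assms(2,3)
proof (induction q arbitrary: s rule: measure_induct_rule[of length])
  case (less q)
  show ?case
  proof (cases q)
    case Nil
    then have "?P s q []" using less.prems assms(1) by simp
    then show ?thesis ..
  next
    case (Cons a q')
    then have a: "a \<in> parcs split" "fst a = base s" "pcas (snd a) q' (base t)"
      "set q' \<subseteq> parcs split" using less.prems by auto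
    from a(1) show ?thesis
    proof (cases rule: parcs_splitE)
      case (1 e)
      have "\<exists>p. ?P (snd e) q' p"
        by (rule less.IH) (use a 1 Cons in auto)
      then obtain p where "?P (snd e) q' p" ..
      then have "?P s q (e # p)" using 1 Cons a assms(1) by simp
      then show ?thesis ..
    next
      case (2 e)
      \<comment> \<open>The walk cannot stop at \<open>mid e\<close>, since it ends in an old
        vertex.\<close>
      then obtain b q'' where q': "q' = b # q''" using a by (cases q') auto
      then have b: "b \<in> parcs split" "fst b = mid e" "pcas (snd b) q'' (base t)"
        "set q'' \<subseteq> parcs split" using a 2 by auto
      \<comment> \<open>The walk may enter by \<open>e\<close> and leave by another edge
        \<open>e'\<close> of the same tail and class; the projection takes \<open>e'\<close>, which
        has the right head.\<close>
      from b(1,2) obtain e' where e': "e' \<in> H" "b = (mid e', base (snd e'))" "mid e' = mid e"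
        by (cases rule: parcs_splitE) auto
      have "\<exists>p. ?P (snd e') q'' p"
        by (rule less.IH) (use b e' q' Cons in auto)
      then obtain p where "?P (snd e') q'' p" ..
      moreover have "fst e' = s" using e'(3) 2 a by (simp add: mid_eq_iff)
      moreover have "mid e \<notin> range base" by auto
      ultimately have "?P s q (e' # p)" using 2 Cons a e' q' H_subset assms(1) by auto
      then show ?thesis ..
    next
      case (3 e)
      then show ?thesis using a by auto
    qed
  qed
qed

lemma fst_in_pawalk_verts: "e \<in> set p \<Longrightarrow> fst e \<in> set (pawalk_verts u p)"
  by (induction p arbitrary: u) auto

text \<open>Each edge of \<open>H\<close> becomes two arcs. A new vertex determines the tail of its
  edges, and tails on a simple path are distinct, so no new vertex repeats. The last clause confines
  the lift to vertices coming from \<open>p\<close> itself.\<close>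

lemma lift_path:
  assumes "set p \<subseteq> parcs G" "pcas s p t" "distinct (pawalk_verts s p)"
  shows "\<exists>q. set q \<subseteq> parcs split \<and> pcas (base s) q (base t) \<and>
     distinct (pawalk_verts (base s) q) \<and>
     set (pawalk_verts (base s) q) \<subseteq> base ` set (pawalk_verts s p) \<union> mid ` (set p \<inter> H)"
  using assms
proof (induction p arbitrary: s)
  case Nil
  then show ?case by (intro exI[of _ "[]"]) auto
next
  case (Cons e p)
  then have s: "fst e = s" "s \<notin> set (pawalk_verts (snd e) p)" by auto
  have "set p \<subseteq> parcs G" "pcas (snd e) p t" "distinct (pawalk_verts (snd e) p)"
    using Cons.prems by auto
  from Cons.IH[OF this] obtain q where q: "set q \<subseteq> parcs split" "pcas (base (snd e)) q (base t)"
    "distinct (pawalk_verts (base (snd e)) q)"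
    "set (pawalk_verts (base (snd e)) q) \<subseteq> base ` set (pawalk_verts (snd e) p) \<union> mid ` (set p \<inter> H)"
    by blast
  have base: "base s \<notin> set (pawalk_verts (base (snd e)) q)"
    using q(4) s(2) by auto
  show ?case
  proof (cases "e \<in> H")
    case True
    have "mid e \<notin> set (pawalk_verts (base (snd e)) q)"
      using q(4) s fst_in_pawalk_verts[of _ p "snd e"] by (auto simp: mid_eq_iff)
    then show ?thesis using q s base True parcs_splitI(2,3)[OF True]
      by (intro exI[of _ "(base s, mid e) # (mid e, base (snd e)) # q"]) auto
  next
    case False
    then show ?thesis using q s base Cons.prems parcs_splitI(1)[of e]
      by (intro exI[of _ "(base s, base (snd e)) # q"]) auto
  qed
qed

end

section \<open>From vertex cuts of the split graph to edge cuts\<close>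

text \<open>Both factors 4 come from \<open>class_weight_le\<close>: once for the total weight, once
  for the inner product of cost and weight.\<close>

lemma edge_gap_bound_of_vertex_gap_bound:
  assumes n: "n > 0" and L: "n \<le> 2 ^ L"
    and K: "\<And>n' W'. n' \<le> n * (L + 2) \<Longrightarrow> 0 \<le> W' \<Longrightarrow> W' \<le> 4 * W \<Longrightarrow> vfg n' W' \<le> K"
  shows "edge_gap_bound n W (4 * K)"
  unfolding edge_gap_bound_def
proof (intro allI impI, elim conjE)
  fix G :: "nat pair_pre_digraph" and cost w :: "nat \<times> nat \<Rightarrow> real"
  assume G: "pair_fin_digraph G" and card: "card (pverts G) = n"
    and cost: "\<forall>e\<in>parcs G. cost e \<ge> 0" and w: "\<forall>e\<in>parcs G. w e \<ge> 0"
    and W: "(\<Sum>e\<in>parcs G. w e) = W"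
  define H where "H = {e\<in>parcs G. 1 \<le> 2 * real n * w e}"
  define \<kappa> where "\<kappa> = weight_class \<circ> w"
  interpret pair_fin_digraph G by fact
  interpret class_split G H \<kappa>
    by unfold_locales (auto simp: H_def)
  interpret S: pair_fin_digraph split by (rule pair_fin_digraph_split)

  have \<kappa>: "weight_class (w e) = \<kappa> e" for e
    by (simp add: \<kappa>_def)
  \<comment> \<open>With \<open>n \<le> 2 ^ L\<close>, weight at least \<open>1 / (2 * n)\<close>
    forces class at most \<open>L\<close>.\<close>
  have heavy: "1 \<le> 2 ^ L * (2 * w e)" if "e \<in> H" for e
  proof -
    have "real n * (2 * w e) \<le> 2 ^ L * (2 * w e)"
      using that w L by (intro mult_right_mono) (auto simp: H_def simp flip: of_nat_le_iff)
    then show ?thesis using that by (auto simp: H_def)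
  qed
  have class_le: "2 / 2 ^ \<kappa> e \<le> 4 * w e" if "e \<in> H" for e
    using class_weight_le[OF heavy[OF that]] by (simp add: \<kappa>_def)

  \<comment> \<open>On a new vertex \<open>i\<close> is the shifted class
    \<open>Suc (\<kappa> e)\<close>, so \<open>4 / 2 ^ i\<close> is the class weight
    \<open>2 / 2 ^ \<kappa> e\<close>.\<close>
  define f :: "nat \<Rightarrow> real" where
    "f x = (let i = snd (prod_decode x) in if i = 0 then 0 else 4 / 2 ^ i)" for x
  have f_base: "f (base v) = 0" for v
    by (simp add: f_def base_def)
  have f_mid: "f (mid e) = 2 / 2 ^ \<kappa> e" for e
    by (simp add: f_def mid_def)
  have f_nonneg: "f x \<ge> 0" for x
    by (simp add: f_def Let_def)

  define E where "E = (\<Sum>e\<in>parcs G. cost e * w e)"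
  \<comment> \<open>One more than the whole budget, so no cut within it contains an old
    vertex.\<close>
  define M where "M = E * 4 * real K + 1"
  define c where "c x = (if x \<in> range base then M else \<Sum>e\<in>{e\<in>H. mid e = x}. cost e)" for x
  have E: "E \<ge> 0" unfolding E_def using cost w by (intro sum_nonneg) auto
  have c_mid: "c x = (\<Sum>e\<in>{e\<in>H. mid e = x}. cost e)" if "x \<in> mid ` H" for x
    using that by (auto simp: c_def)
  have c_nonneg: "c x \<ge> 0" for x
    unfolding c_def using E cost H_subset by (auto simp: M_def intro!: sum_nonneg)
  have sum_split: "(\<Sum>x\<in>pverts split. g x) = (\<Sum>x\<in>mid ` H. g x)"
    if "\<And>v. g (base v) = 0" for g :: "nat \<Rightarrow> real"
    unfolding pverts_split using pair_finite_verts finite_H that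
    by (intro sum.mono_neutral_right) auto

  define n' where "n' = card (pverts split)"
  define W' where "W' = (\<Sum>x\<in>pverts split. f x)"
  have "n' \<le> n * (L + 2)"
    unfolding n'_def using card_pverts_split[of L] weight_class_le[OF heavy] card
    by (auto simp: \<kappa>_def)
  moreover have "0 \<le> W'"
    unfolding W'_def by (intro sum_nonneg) (simp add: f_nonneg)
  moreover have "W' \<le> 4 * W"
  proof -
    have "W' = (\<Sum>x\<in>mid ` H. f x)"
      unfolding W'_def by (rule sum_split) (rule f_base)
    also have "\<dots> \<le> (\<Sum>e\<in>H. f (mid e))"
      using sum_image_le[OF finite_H, of f mid] f_nonneg by auto
    also have "\<dots> \<le> (\<Sum>e\<in>H. 4 * w e)"
      using class_le by (intro sum_mono) (simp add: f_mid)
    also have "\<dots> \<le> (\<Sum>e\<in>parcs G. 4 * w e)"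
      using H_subset pair_finite_arcs w by (intro sum_mono2) auto
    finally show ?thesis using W by (simp flip: sum_distrib_left)
  qed
  ultimately have vfg: "vfg n' W' \<le> K" by (rule K)

  have cf: "(\<Sum>x\<in>pverts split. c x * f x) \<le> 4 * E"
  proof -
    have "(\<Sum>x\<in>pverts split. c x * f x) = (\<Sum>x\<in>mid ` H. c x * f x)"
      by (rule sum_split) (simp add: f_base)
    \<comment> \<open>All edges in a fibre of \<open>mid\<close> see the same \<open>f\<close>, so
      the sum over vertices unfolds into one over edges.\<close>
    also have "\<dots> = (\<Sum>x\<in>mid ` H. \<Sum>e\<in>{e\<in>H. mid e = x}. cost e * f (mid e))"
      by (intro sum.cong refl) (simp add: c_mid sum_distrib_right)
    also have "\<dots> = (\<Sum>e\<in>H. cost e * f (mid e))"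
      by (rule sum.group) (use finite_H in auto)
    also have "\<dots> \<le> (\<Sum>e\<in>H. cost e * (4 * w e))"
      using class_le cost H_subset by (intro sum_mono mult_left_mono) (auto simp: f_mid)
    also have "\<dots> \<le> (\<Sum>e\<in>parcs G. cost e * (4 * w e))"
      using H_subset pair_finite_arcs w cost by (intro sum_mono2) auto
    finally show ?thesis by (simp add: E_def sum_distrib_left mult_ac)
  qed
  obtain X' where X': "vertex_cut split f X'"
    "(\<Sum>x\<in>X'. c x) \<le> (\<Sum>x\<in>pverts split. c x * f x) * real (vfg n' W')"
    using vertex_gap_bound_vfg[of n' W', unfolded vertex_gap_bound_def, rule_format, of split c f]
      S.pair_fin_digraph f_nonneg c_nonneg
    by (auto simp: n'_def W'_def)
  have X'_sub: "X' \<subseteq> pverts split" using X'(1) by (simp add: vertex_cut_def)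
  then have fin_X': "finite X'" using S.pair_finite_verts finite_subset by blast
  have "(\<Sum>x\<in>X'. c x) \<le> (4 * E) * real K"
    using X'(2) cf vfg E by (elim order_trans) (intro mult_mono; simp)
  then have cX': "(\<Sum>x\<in>X'. c x) \<le> E * real (4 * K)" by simp
  have X'_mid: "X' \<subseteq> mid ` H"
  proof
    fix x assume x: "x \<in> X'"
    have "c x \<le> (\<Sum>x\<in>X'. c x)"
      using x fin_X' c_nonneg by (intro member_le_sum) auto
    then have "x \<notin> range base" using cX' by (auto simp: c_def M_def)
    then show "x \<in> mid ` H" using x X'_sub by (auto simp: pverts_split)
  qed

  \<comment> \<open>Taking whole fibres of \<open>mid\<close> makes the cost of \<open>X\<close>
    equal to that of \<open>X'\<close>.\<close>
  define X where "X = {e\<in>H. mid e \<in> X'}"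
  have "(\<Sum>e\<in>X. cost e) = (\<Sum>x\<in>X'. \<Sum>e\<in>{e\<in>X. mid e = x}. cost e)"
    by (rule sum.group[symmetric]) (use finite_H fin_X' in \<open>auto simp: X_def\<close>)
  also have "\<dots> = (\<Sum>x\<in>X'. c x)"
  proof (rule sum.cong)
    fix x assume x: "x \<in> X'"
    then have "c x = (\<Sum>e\<in>{e\<in>H. mid e = x}. cost e)" using X'_mid c_mid by blast
    moreover have "{e\<in>X. mid e = x} = {e\<in>H. mid e = x}" using x by (auto simp: X_def)
    ultimately show "(\<Sum>e\<in>{e\<in>X. mid e = x}. cost e) = c x" by simp
  qed simp
  finally have cX: "(\<Sum>e\<in>X. cost e) \<le> E * real (4 * K)" using cX' by simp

  have "edge_cut G w X"
    unfolding edge_cut_def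
  proof (intro conjI ballI allI impI)
    show "X \<subseteq> parcs G" using H_subset by (auto simp: X_def)
  next
    fix s t p
    assume st: "s \<in> pverts G" "t \<in> pverts G" and d: "edge_dist G w s t \<ge> 1" and p: "apath s p t"
    \<comment> \<open>\<open>X'\<close> is guaranteed to meet the lift of \<open>p\<close> once all
      competing paths \<open>q\<close> have interior weight at least 1, which projection and
      rounding provide.\<close>
    have "1 \<le> vertex_dist split f (base s) (base t)"
      unfolding vertex_dist_def
    proof (intro INF_greatest, clarify)
      fix q assume q: "S.apath (base s) q (base t)"
      obtain r where r: "set r \<subseteq> parcs G" "pcas s r t"
        "filter (\<lambda>x. x \<in> range base) (pawalk_verts (base s) q) = map base (pawalk_verts s r)"
        "sum_list (map f (pawalk_verts (base s) q)) = (\<Sum>e\<leftarrow>r. if e \<in> H then f (mid e) else 0)"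
        using project_walk[of f q s t] f_base q by (auto simp: S.apath_def S.awalk_def)
      have "distinct (map base (pawalk_verts s r))"
        using q unfolding r(3)[symmetric] by (simp add: S.apath_def)
      then have r_path: "apath s r t"
        using r(1,2) st by (simp add: apath_def awalk_def distinct_map)
      then have "awalk s r t" by (simp add: apath_def)
      from order_trans[OF d min_cost_le_walk_cost[OF this]] have "1 \<le> ereal (awalk_cost w r)" .
      then have "1 \<le> sum_list (map w r)" by (simp add: awalk_cost_def)
      then have "1 \<le> (\<Sum>x\<leftarrow>map w r. if 1 \<le> 2 * real n * x then 2 / 2 ^ weight_class x else (0 :: real))"
        using apath_length_less[OF G r_path] card by (intro rounded_sum_ge_one) auto
      also have "\<dots> = (\<Sum>e\<leftarrow>r. if e \<in> H then f (mid e) else 0)"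
        unfolding map_map using r(1)
        by (intro arg_cong[of _ _ sum_list] map_cong refl) (use \<kappa> in \<open>auto simp: f_mid H_def\<close>)
      \<comment> \<open>Both end vertices are old and have \<open>f\<close>-value 0, so dropping
        them loses nothing.\<close>
      also have "\<dots> = sum_list (map f (S.inner_verts q))"
      proof (cases q)
        case Nil
        then show ?thesis using r(4) f_base by simp
      next
        case (Cons a q')
        have "snd (last q) = base t" "fst (hd q) = base s"
          using q Cons S.awlast_of_awalk[of "base s" q "base t"]
          by (auto simp: S.apath_def S.awalk_def S.awalk_verts_conv)
        then show ?thesis using r(4) f_base Cons
          by (simp add: S.awalk_verts_conv S.inner_verts_def del: pawalk_verts.simps)
      qed
      finally show "1 \<le> ereal (sum_list (map f (S.inner_verts q)))" by simp
    qed
    moreover obtain q where q: "S.apath (base s) q (base t)"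
      "set (pawalk_verts (base s) q) \<subseteq> base ` set (pawalk_verts s p) \<union> mid ` (set p \<inter> H)"
      using lift_path[of p s t] p st
      by (auto simp: S.apath_def S.awalk_def apath_def awalk_def pverts_split)
    moreover have "base s \<in> pverts split" "base t \<in> pverts split"
      using st by (auto simp: pverts_split)
    ultimately have "set (S.inner_verts q) \<inter> X' \<noteq> {}"
      using X'(1) by (auto simp: vertex_cut_def)
    then obtain x where x: "x \<in> set (S.inner_verts q)" "x \<in> X'" by auto
    have "x \<in> set (pawalk_verts (base s) q)"
      using x(1) S.inner_verts_conv[of q "base s"] by (auto dest!: in_set_butlastD list_set_tl)
    \<comment> \<open>\<open>X'\<close> holds new vertices only, so the vertex hit on the lift is
      \<open>mid e\<close> for an edge \<open>e\<close> of \<open>p\<close>, and then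
      \<open>e\<close> is in \<open>X\<close>.\<close>
    moreover have "x \<notin> base ` set (pawalk_verts s p)"
      using x(2) X'_mid by auto
    ultimately obtain e where "e \<in> set p \<inter> H" "x = mid e"
      using q(2) by blast
    then show "set p \<inter> X \<noteq> {}" using x(2) by (auto simp: X_def)
  qed
  then show "\<exists>X. edge_cut G w X \<and> (\<Sum>e\<in>X. cost e) \<le> (\<Sum>e\<in>parcs G. cost e * w e) * real (4 * K)"
    using cX by (auto simp: E_def)
qed

section \<open>Choice of the absolute constant\<close>

theorem theorem8:
  shows "\<exists>C::real. C > 0 \<and>
    (\<forall>(n::nat) (W::real). n \<ge> 2 \<and> W \<ge> 0 \<longrightarrow>
      real (efg n W) \<le>
        C * real (Max {vfg n' W' | n' W'.
                         real n' \<le> C * real n * log 2 (real n) \<and> 0 \<le> W' \<and> W' \<le> C * W}))"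
proof (intro exI[of _ 4] conjI allI impI)
  fix n :: nat and W :: real
  assume nW: "n \<ge> 2 \<and> W \<ge> 0"
  \<comment> \<open>The same 4 bounds the number of vertices, the growth of the weight and the loss
    in the gap.\<close>
  let ?V = "{vfg n' W' | n' W'. real n' \<le> 4 * real n * log 2 (real n) \<and> 0 \<le> W' \<and> W' \<le> 4 * W}"
  define L where "L = nat \<lceil>log 2 (real n)\<rceil>"
  have log: "log 2 (real n) \<ge> 1" using nW by (simp add: le_log_iff)
  have L_ge: "log 2 (real n) \<le> real L" and L_le: "real L \<le> log 2 (real n) + 1"
    unfolding L_def using log by linarith+
  have "real n \<le> 2 powr real L" using L_ge nW by (simp add: log_le_iff)
  then have n_le: "n \<le> 2 ^ L"
    by (simp add: powr_realpow flip: of_nat_le_iff)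
  have size: "real n' \<le> 4 * real n * log 2 (real n)" if "n' \<le> n * (L + 2)" for n'
  proof -
    have "real n' \<le> real n * (real L + 2)"
      using of_nat_mono[OF that, where 'a = real] by (simp only: of_nat_mult of_nat_add of_nat_numeral)
    \<comment> \<open>\<open>L + 2 \<le> log 2 n + 3\<close>, and \<open>log 2 n \<ge> 1\<close>
      absorbs the additive constant.\<close>
    also have "\<dots> \<le> real n * (4 * log 2 (real n))"
      using L_le log by (intro mult_left_mono) auto
    finally show ?thesis by simp
  qed
  have "edge_gap_bound n W (4 * Max ?V)"
  proof (rule edge_gap_bound_of_vertex_gap_bound[OF _ n_le])
    fix n' W' assume "n' \<le> n * (L + 2)" "0 \<le> W'" "W' \<le> 4 * W"
    then show "vfg n' W' \<le> Max ?V"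
      using size by (intro Max_ge finite_vfg_values) blast
  qed (use nW in simp)
  then have "efg n W \<le> 4 * Max ?V"
    unfolding efg_def by (rule Least_le)
  then show "real (efg n W) \<le> 4 * real (Max ?V)"
    by (simp flip: of_nat_le_iff)
qed simp

end
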